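(* Let $a,q\in(0,1)$ and let $\mathfrak h$ be the height function of the stochastic six-vertex model with parameters $a,q$ and step initial condition. Fix any integers $M,N\ge 8$ and real numbers $r_1,r_2\ge 0$. Then $$\mathbb P\big(\mathfrak h(M,N)\ge r_1\big)\,\mathbb P\big(\mathfrak h(M,N)\ge r_2\big)\le N^2\,\mathsf C^{(MN)^{4/5}}\left[\mathbb P\Big(\mathfrak h(M,N)\ge \tfrac{r_1+r_2}{2}-4(MN)^{2/5}\Big)\right]^2,$$ where $\mathsf C:=a^{-2}q^{-2}(1-a)^{-2}(1-q)^{-2}(1-aq)^4$.
   Context: Stochastic six-vertex model (step initial condition). Fix $a,q\in(0,1)$. To a vertex with $i_1\in\{0,1\}$ arrows entering vertically from below, $j_1\in\{0,1\}$ arrows entering horizontally from the left, $i_2\in\{0,1\}$ arrows leaving vertically upward and $j_2\in\{0,1\}$ arrows leaving horizontally to the right, with $i_1+j_1=i_2+j_2$, assign the weight $w(i_1,j_1;i_2,j_2)$: $w(0,0;0,0)=w(1,1;1,1)=1$, $w(1,0;1,0)=\frac{q(1-a)}{1-aq}$, $w(1,0;0,1)=\frac{1-q}{1-aq}$, $w(0,1;0,1)=\frac{1-a}{1-aq}$, $w(0,1;1,0)=\frac{a(1-q)}{1-aq}$. The model is a random configuration of up-right arrow paths on the vertices $\mathbb Z_{\ge1}^2$. Every vertex $(1,n)$, $n\ge1$, has an incoming horizontal arrow from the left, and no vertex $(m,1)$, $m\ge1$, has an incoming vertical arrow from below. Vertices are sampled successively along the antidiagonals $x+y=2,3,4,\dots$: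 given the incoming arrows $(i_1,j_1)$ at a vertex, its outgoing arrows $(i_2,j_2)$ are chosen with probability $w(i_1,j_1;i_2,j_2)$, independently over the vertices of an antidiagonal; outgoing arrows of a vertex are incoming arrows of its upper and right neighbours. Height function: $\mathfrak h(M,N)$ is the number of paths that pass through or to the right of $(M,N)$; explicitly, $\mathfrak h(M,N)=N-\#\{x\in\mathbb Z: 1\le x\le M-1,\ \text{there is an arrow from }(x,N)\text{ to }(x,N+1)\}$. *)

theory Defs
  imports "HOL-Probability.Probability"
begin

text \<open>
  Arrows are Booleans. In every pair of arrows the first component is the vertical and the second
  the horizontal one, so \<open>s6v_weight a q (i1, j1) (i2, j2)\<close> is the weight written
  $w(i_1,j_1;i_2,j_2)$ in the literature. Pairs violating $i_1+j_1=i_2+j_2$ get weight 0.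
\<close>

fun s6v_weight :: "real \<Rightarrow> real \<Rightarrow> bool \<times> bool \<Rightarrow> bool \<times> bool \<Rightarrow> real" where
  "s6v_weight a q (False, False) (False, False) = 1"
| "s6v_weight a q (True, True) (True, True) = 1"
| "s6v_weight a q (True, False) (True, False) = q * (1 - a) / (1 - a * q)"
| "s6v_weight a q (True, False) (False, True) = (1 - q) / (1 - a * q)"
| "s6v_weight a q (False, True) (False, True) = (1 - a) / (1 - a * q)"
| "s6v_weight a q (False, True) (True, False) = a * (1 - q) / (1 - a * q)"
| "s6v_weight a q _ _ = 0"

text \<open>
  A configuration records the outgoing arrows of each vertex; its values outside
  $\mathbb{Z}_{\ge 1}^2$ are never used.
\<close>

type_synonym s6v_config = "nat \<times> nat \<Rightarrow> bool \<times> bool"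

definition s6v_in :: "s6v_config \<Rightarrow> nat \<times> nat \<Rightarrow> bool \<times> bool" where
  "s6v_in c = (\<lambda>(x, y). (if y = 1 then False else fst (c (x, y - 1)),
                         if x = 1 then True else snd (c (x - 1, y))))"

definition s6v_diag :: "nat \<Rightarrow> (nat \<times> nat) set" where
  "s6v_diag n = {(x, y). 1 \<le> x \<and> 1 \<le> y \<and> x + y = n}"

definition s6v_below :: "nat \<Rightarrow> (nat \<times> nat) set" where
  "s6v_below n = {(x, y). 1 \<le> x \<and> 1 \<le> y \<and> x + y < n}"

text \<open>
  The random configuration \<open>\<eta>\<close> on a probability space \<open>P\<close>. Sequential sampling is expressed
  by conditioning on everything already sampled: given the arrows out of the vertices with
  $x+y<n$, the outputs on the antidiagonal $x+y=n$ are independent, each with the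
  probability prescribed by the weight for the incoming arrows. Arrow conservation at a
  vertex thus holds almost surely.
\<close>

locale stochastic_six_vertex = prob_space P
  for P :: "'w measure" and a q :: real and \<eta> :: "'w \<Rightarrow> s6v_config" +
  assumes measurable_arrows:
    "\<And>x y. 1 \<le> x \<Longrightarrow> 1 \<le> y \<Longrightarrow> (\<lambda>\<omega>. \<eta> \<omega> (x, y)) \<in> P \<rightarrow>\<^sub>M count_space UNIV"
  and sampling:
    "\<And>n c. 2 \<le> n \<Longrightarrow> \<P>(\<omega> in P. \<forall>v\<in>s6v_below n. \<eta> \<omega> v = c v) > 0 \<Longrightarrow>
       \<P>(\<omega> in P. (\<forall>v\<in>s6v_diag n. \<eta> \<omega> v = c v) \<bar> (\<forall>v\<in>s6v_below n. \<eta> \<omega> v = c v)) =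
       (\<Prod>v\<in>s6v_diag n. s6v_weight a q (s6v_in c v) (c v))"

definition s6v_height :: "s6v_config \<Rightarrow> nat \<Rightarrow> nat \<Rightarrow> int" where
  "s6v_height c M N = int N - int (card {x. 1 \<le> x \<and> x \<le> M - 1 \<and> fst (c (x, N))})"

end

theory Submission
  imports Defs
begin

text \<open>
  On the vertices \<open>{1..M-1} \<times> {1..N}\<close> a configuration is the same as an integer height
  function \<open>G\<close> on the faces with increments in \<open>{0, 1}\<close>, and
  \<open>G (M - 1, N)\<close> is the height at \<open>(M, N)\<close>. Given two independent height functions
  \<open>G1\<close>, \<open>G2\<close> and an integer \<open>d > 0\<close>, exchange \<open>G1\<close> with
  \<open>G2 + d\<close> on the connected cluster of the corner in the set where \<open>G1 - G2 \<noteq> d\<close>.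
  Since \<open>G1 - G2\<close> changes by at most 1 between neighbouring faces, the cluster is surrounded by
  faces with \<open>G1 - G2 = d\<close>, so the outcome is again a pair of height functions; the exchange
  is an involution, and it replaces the corner heights \<open>k1\<close>, \<open>k2\<close> by
  \<open>k2 + d\<close>, \<open>k1 - d\<close>. The product of the two weights changes only along the level set
  \<open>G1 - G2 = d\<close>, at each vertex by a factor of at most \<open>C\<close>. The error term
  \<open>4 (M N) powr (2/5)\<close> leaves about \<open>8 (M N) powr (2/5)\<close> admissible values of
  \<open>d\<close>, so by the pigeonhole principle one of these level sets is short; the chosen
  \<open>d < N\<close> is the only information lost.
\<close>

section \<open>Probabilities of configurations\<close>

definition conserved :: "bool \<times> bool \<Rightarrow> bool \<times> bool \<Rightarrow> bool" where
  "conserved i j \<longleftrightarrow> (of_bool (fst i) + of_bool (snd i) :: int) = of_bool (fst j) + of_bool (snd j)"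

lemma weight_eq_0: "\<not> conserved i j \<Longrightarrow> s6v_weight a q i j = 0"
  by (cases "(a, q, i, j)" rule: s6v_weight.cases) (auto simp: conserved_def)

text \<open>Put \<open>u = q * (1 - a) / (1 - a * q)\<close> and
  \<open>v = a * (1 - q) / (1 - a * q)\<close>. The conserving weights are \<open>1\<close>,
  \<open>u\<close>, \<open>v\<close>, \<open>1 - u\<close>, \<open>1 - v\<close>, where
  \<open>u = q * (1 - v)\<close> and \<open>v = a * (1 - u)\<close>, so \<open>u * v\<close> lies
  below all of them. The constant \<open>C\<close> of the theorem is
  \<open>1 / (u * v)^2\<close>.\<close>

lemma weight_bounds:
  assumes "0 < a" "a < 1" "0 < q" "q < 1" "conserved i j"
  shows "a * q * (1 - a) * (1 - q) / (1 - a * q)^2 \<le> s6v_weight a q i j"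
    and "s6v_weight a q i j \<le> 1"
    and "0 < s6v_weight a q i j"
proof -
  have aq: "0 < 1 - a * q"
    using assms mult_strict_mono[of a 1 q 1] by simp
  define u where "u = q * (1 - a) / (1 - a * q)"
  define v where "v = a * (1 - q) / (1 - a * q)"
  have u: "0 < u" and v: "0 < v"
    unfolding u_def v_def using assms aq by (intro divide_pos_pos mult_pos_pos; simp)+
  have "1 - u = (1 - a * q - q * (1 - a)) / (1 - a * q)"
    unfolding u_def using aq by (simp add: diff_divide_distrib)
  then have 1: "1 - u = (1 - q) / (1 - a * q)"
    by (simp add: algebra_simps)
  have "1 - v = (1 - a * q - a * (1 - q)) / (1 - a * q)"
    unfolding v_def using aq by (simp add: diff_divide_distrib)
  then have 2: "1 - v = (1 - a) / (1 - a * q)"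
    by (simp add: algebra_simps)
  have uv: "a * q * (1 - a) * (1 - q) / (1 - a * q)^2 = u * v"
    by (simp add: u_def v_def power2_eq_square mult_ac)
  have vu: "v \<le> 1 - u" "u \<le> 1 - v"
    unfolding 1 unfolding 2 unfolding u_def v_def using assms aq
    by (intro divide_right_mono; simp add: mult_left_le_one_le)+
  have "u * v \<le> u" "u * v \<le> v"
    using u v vu mult_left_le[of v u] mult_left_le_one_le[of v u] by simp_all
  then have le: "u * v \<le> u" "u * v \<le> v" "u * v \<le> 1 - u" "u * v \<le> 1 - v" "u * v \<le> 1"
    using u v vu by linarith+
  have w: "s6v_weight a q i j \<in> {1, u, v, 1 - u, 1 - v}"
    unfolding 1 unfolding 2 unfolding u_def v_def using \<open>conserved i j\<close>
    by (cases i; cases j; cases "fst i"; cases "snd i"; cases "fst j"; cases "snd j")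
      (simp_all add: conserved_def)
  show "a * q * (1 - a) * (1 - q) / (1 - a * q)^2 \<le> s6v_weight a q i j"
    unfolding uv using w le by auto
  show "s6v_weight a q i j \<le> 1" "0 < s6v_weight a q i j"
    using w u v vu by auto
qed

lemma sum_weight_eq_1:
  assumes "a * q \<noteq> 1"
  shows "(\<Sum>j\<in>UNIV. s6v_weight a q i j) = 1"
proof -
  have UNIV: "(UNIV :: (bool \<times> bool) set)
      = {(False, False), (False, True), (True, False), (True, True)}"
    by auto
  have eq: "a * (1 - q) + (1 - a) = 1 - a * q" "q * (1 - a) + (1 - q) = 1 - a * q"
    by (simp_all add: algebra_simps)
  have "1 - a * q \<noteq> 0"
    using assms by simp
  then have "a * (1 - q) / (1 - a * q) + (1 - a) / (1 - a * q) = 1"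
    "q * (1 - a) / (1 - a * q) + (1 - q) / (1 - a * q) = 1"
    by (simp_all only: eq divide_self not_False_eq_True flip: add_divide_distrib)
  then show ?thesis
    unfolding UNIV by (cases i; cases "fst i"; cases "snd i") (simp_all add: add.commute)
qed

section \<open>Joint law of the arrows on finite sets of vertices\<close>

lemma finite_s6v_below: "finite (s6v_below n)"
  by (rule finite_subset[of _ "{..n} \<times> {..n}"]) (auto simp: s6v_below_def)

lemma finite_s6v_diag: "finite (s6v_diag n)"
  by (rule finite_subset[of _ "{..n} \<times> {..n}"]) (auto simp: s6v_diag_def)

lemma s6v_below_Suc: "s6v_below (Suc n) = s6v_diag n \<union> s6v_below n"
  by (auto simp: s6v_below_def s6v_diag_def)

lemma s6v_in_cong:
  assumes "1 < x \<Longrightarrow> c (x - 1, y) = c' (x - 1, y)" "1 < y \<Longrightarrow> c (x, y - 1) = c' (x, y - 1)"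
    and "1 \<le> x" "1 \<le> y"
  shows "s6v_in c (x, y) = s6v_in c' (x, y)"
  using assms by (auto simp: s6v_in_def)

text \<open>The inputs of a vertex in such a set are boundary arrows or outputs of vertices of the
  set, so its weights see no arrow from outside. Rectangles and the sets \<open>s6v_below n\<close>
  are of this kind.\<close>

definition lower_set :: "(nat \<times> nat) set \<Rightarrow> bool" where
  "lower_set S \<longleftrightarrow> (\<forall>(x, y)\<in>S. 1 \<le> x \<and> 1 \<le> y \<and> {1..x} \<times> {1..y} \<subseteq> S)"

context stochastic_six_vertex
begin

lemma sets_arrows:
  assumes "finite S" "\<And>x y. (x, y) \<in> S \<Longrightarrow> 1 \<le> x \<and> 1 \<le> y"
  shows "{\<omega> \<in> space P. \<forall>v\<in>S. \<eta> \<omega> v = c v} \<in> events"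
proof -
  have "{\<omega> \<in> space P. \<eta> \<omega> v = c v} \<in> events" if "v \<in> S" for v
  proof -
    have "(\<lambda>\<omega>. \<eta> \<omega> v) -` {c v} \<inter> space P \<in> events"
      using measurable_arrows[of "fst v" "snd v"] assms(2)[of "fst v" "snd v"] that
      by (auto intro: measurable_sets)
    then show ?thesis
      by (simp add: vimage_def Int_def conj_commute)
  qed
  then show ?thesis
    using assms(1) by (intro sets.sets_Collect_finite_All) auto
qed

text \<open>Induction over the antidiagonals: the sampling rule multiplies the probability by the
  weights on the next one.\<close>

lemma prob_below:
  "prob {\<omega> \<in> space P. \<forall>v\<in>s6v_below n. \<eta> \<omega> v = c v}
     = (\<Prod>v\<in>s6v_below n. s6v_weight a q (s6v_in c v) (c v))"
proof (induction n)
  case 0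
  then show ?case by (simp add: s6v_below_def prob_space)
next
  case (Suc n)
  let ?B = "\<lambda>\<omega>. \<forall>v\<in>s6v_below n. \<eta> \<omega> v = c v"
  let ?D = "\<lambda>\<omega>. \<forall>v\<in>s6v_diag n. \<eta> \<omega> v = c v"
  have disj: "s6v_diag n \<inter> s6v_below n = {}"
    by (auto simp: s6v_diag_def s6v_below_def)
  have split: "{\<omega> \<in> space P. \<forall>v\<in>s6v_below (Suc n). \<eta> \<omega> v = c v} = {\<omega> \<in> space P. ?D \<omega> \<and> ?B \<omega>}"
    by (auto simp: s6v_below_Suc)
  have prod: "(\<Prod>v\<in>s6v_below (Suc n). s6v_weight a q (s6v_in c v) (c v))
      = (\<Prod>v\<in>s6v_diag n. s6v_weight a q (s6v_in c v) (c v)) * prob {\<omega> \<in> space P. ?B \<omega>}"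
    unfolding Suc s6v_below_Suc
    by (rule prod.union_disjoint[OF finite_s6v_diag finite_s6v_below disj])
  show ?case
  proof (cases "2 \<le> n \<and> prob {\<omega> \<in> space P. ?B \<omega>} > 0")
    case True
    then have "\<P>(\<omega> in P. ?D \<omega> \<bar> ?B \<omega>) = (\<Prod>v\<in>s6v_diag n. s6v_weight a q (s6v_in c v) (c v))"
      by (intro sampling) auto
    then show ?thesis
      using True unfolding split prod cond_prob_def by (simp add: field_simps)
  next
    \<comment> \<open>Either \<open>n < 2\<close> and the antidiagonal is empty, or the conditioning
      event is null and both sides vanish.\<close>
    case False
    have "s6v_diag n = {}" if "n < 2"
      using that by (auto simp: s6v_diag_def)
    moreover have "prob {\<omega> \<in> space P. ?D \<omega> \<and> ?B \<omega>} \<le> prob {\<omega> \<in> space P. ?B \<omega>}"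
      by (intro finite_measure_mono sets_arrows finite_s6v_below) (auto simp: s6v_below_def)
    then have "prob {\<omega> \<in> space P. ?D \<omega> \<and> ?B \<omega>} = 0" "prob {\<omega> \<in> space P. ?B \<omega>} = 0"
      if "\<not> n < 2"
      using False that
      by (auto simp: not_less intro: antisym order_trans[OF _ measure_nonneg] measure_nonneg)
    ultimately show ?thesis
      unfolding split prod by (cases "n < 2") auto
  qed
qed

text \<open>Works downward from \<open>s6v_below n\<close>: add a lowest missing vertex to
  \<open>S\<close>, apply the claim to the larger set, and sum over the four outputs of that vertex,
  whose weights add up to 1.\<close>

lemma prob_lower_set:
  assumes "a * q \<noteq> 1" "lower_set S" "S \<subseteq> s6v_below n"
  shows "prob {\<omega> \<in> space P. \<forall>v\<in>S. \<eta> \<omega> v = c v} = (\<Prod>v\<in>S. s6v_weight a q (s6v_in c v) (c v))"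
  using assms(2,3)
proof (induction "card (s6v_below n - S)" arbitrary: S c rule: less_induct)
  case less
  show ?case
  proof (cases "s6v_below n \<subseteq> S")
    case True
    with less.prems have "S = s6v_below n" by auto
    then show ?thesis by (simp add: prob_below)
  next
    case False
    \<comment> \<open>Minimality of \<open>x + y\<close> puts every other vertex to the lower left
      of \<open>v\<close> into \<open>S\<close>, so \<open>insert v S\<close> is again a lower
      set.\<close>
    then obtain v where v: "v \<in> s6v_below n - S"
      and min: "\<And>u. u \<in> s6v_below n - S \<Longrightarrow> fst v + snd v \<le> fst u + snd u"
      using ex_has_least_nat[of "\<lambda>v. v \<in> s6v_below n - S" _ "\<lambda>v. fst v + snd v"] by blast
    obtain x y where xy: "v = (x, y)" by (cases v)
    have pos: "1 \<le> x" "1 \<le> y" "x + y < n" using v xy by (auto simp: s6v_below_def)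
    have pred: "u \<in> S" if "u \<in> {1..x} \<times> {1..y}" "u \<noteq> v" for u
    proof (rule ccontr)
      assume "u \<notin> S"
      with that pos have "u \<in> s6v_below n - S" by (auto simp: s6v_below_def)
      from min[OF this] that xy show False by auto
    qed
    have fin: "finite S" using less.prems(2) finite_s6v_below finite_subset by blast
    have S1: "1 \<le> x' \<and> 1 \<le> y'" if "(x', y') \<in> S" for x' y'
      using that less.prems(1) by (auto simp: lower_set_def)
    have lower: "lower_set (insert v S)"
      using less.prems(1) pred pos unfolding lower_set_def xy by blast
    have IH: "prob {\<omega> \<in> space P. \<forall>u\<in>insert v S. \<eta> \<omega> u = c' u}
        = (\<Prod>u\<in>insert v S. s6v_weight a q (s6v_in c' u) (c' u))" for c'
    proof (rule less.hyps)
      show "card (s6v_below n - insert v S) < card (s6v_below n - S)"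
        using v by (intro psubset_card_mono) (auto simp: finite_s6v_below)
    qed (use lower v less.prems in auto)
    let ?c = "\<lambda>j. c(v := j)"
    \<comment> \<open>\<open>v\<close> feeds no vertex of \<open>insert v S\<close>: a vertex fed by
      it would lie in \<open>S\<close>, and then so would \<open>v\<close>. Changing the output at
      \<open>v\<close> therefore changes none of these inputs.\<close>
    have S_cong: "s6v_in (?c j) u = s6v_in c u" if "u \<in> insert v S" for j u
    proof -
      obtain x' y' where u: "u = (x', y')" by (cases u)
      have "(x' - 1, y') \<noteq> v" if "1 < x'"
      proof
        assume *: "(x' - 1, y') = v"
        have "u \<noteq> v" using * u that by auto
        then have "u \<in> S" using \<open>u \<in> insert v S\<close> by simp
        then have "{1..x'} \<times> {1..y'} \<subseteq> S" using less.prems(1) by (auto simp: lower_set_def u)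
        moreover have "v \<in> {1..x'} \<times> {1..y'}" using * xy pos by auto
        ultimately show False using v by auto
      qed
      moreover have "(x', y' - 1) \<noteq> v" if "1 < y'"
      proof
        assume *: "(x', y' - 1) = v"
        have "u \<noteq> v" using * u that by auto
        then have "u \<in> S" using \<open>u \<in> insert v S\<close> by simp
        then have "{1..x'} \<times> {1..y'} \<subseteq> S" using less.prems(1) by (auto simp: lower_set_def u)
        moreover have "v \<in> {1..x'} \<times> {1..y'}" using * xy pos by auto
        ultimately show False using v by auto
      qed
      moreover have "1 \<le> x' \<and> 1 \<le> y'"
        using that pos S1 u xy by auto
      ultimately show ?thesis unfolding u by (intro s6v_in_cong) auto
    qed
    have "{\<omega> \<in> space P. \<forall>u\<in>S. \<eta> \<omega> u = c u}
        = (\<Union>j\<in>UNIV. {\<omega> \<in> space P. \<forall>u\<in>insert v S. \<eta> \<omega> u = ?c j u})"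
      using v by (auto split: if_splits)
    also have "prob \<dots> = (\<Sum>j\<in>UNIV. prob {\<omega> \<in> space P. \<forall>u\<in>insert v S. \<eta> \<omega> u = ?c j u})"
    proof (rule finite_measure_finite_Union)
      have "{\<omega> \<in> space P. \<forall>u\<in>insert v S. \<eta> \<omega> u = ?c j u} \<in> events" for j
        by (rule sets_arrows) (use fin S1 pos xy in auto)
      then show "(\<lambda>j. {\<omega> \<in> space P. \<forall>u\<in>insert v S. \<eta> \<omega> u = ?c j u}) ` UNIV \<subseteq> events"
        by blast
    qed (auto simp: disjoint_family_on_def)
    also have "\<dots> = (\<Sum>j\<in>UNIV. s6v_weight a q (s6v_in c v) j
        * (\<Prod>u\<in>S. s6v_weight a q (s6v_in c u) (c u)))"
    proof (rule sum.cong[OF refl])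
      fix j
      have "(\<Prod>u\<in>S. s6v_weight a q (s6v_in (?c j) u) (?c j u))
          = (\<Prod>u\<in>S. s6v_weight a q (s6v_in c u) (c u))"
        using v S_cong by (intro prod.cong) auto
      then show "prob {\<omega> \<in> space P. \<forall>u\<in>insert v S. \<eta> \<omega> u = ?c j u} = s6v_weight a q (s6v_in c v) j
          * (\<Prod>u\<in>S. s6v_weight a q (s6v_in c u) (c u))"
        unfolding IH using v fin S_cong[of v j] by (subst prod.insert) auto
    qed
    also have "\<dots> = (\<Prod>u\<in>S. s6v_weight a q (s6v_in c u) (c u))"
      by (simp add: sum_weight_eq_1 assms(1) flip: sum_distrib_right)
    finally show ?thesis .
  qed
qed

text \<open>Splits the event by the restriction of the configuration to the rectangle; extensional
  functions list each restriction once.\<close>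

lemma prob_rectangle:
  assumes "a * q \<noteq> 1" and Q: "\<And>c c'. (\<And>v. v \<in> {1..m} \<times> {1..n} \<Longrightarrow> c v = c' v) \<Longrightarrow> Q c = Q c'"
  shows "prob {\<omega> \<in> space P. Q (\<eta> \<omega>)}
    = (\<Sum>c\<in>{c \<in> ({1..m} \<times> {1..n}) \<rightarrow>\<^sub>E UNIV. Q c}.
        \<Prod>v\<in>{1..m} \<times> {1..n}. s6v_weight a q (s6v_in c v) (c v))"
proof -
  let ?R = "{1..m} \<times> {1..n}"
  let ?E = "\<lambda>c. {\<omega> \<in> space P. \<forall>v\<in>?R. \<eta> \<omega> v = c v}"
  have "{\<omega> \<in> space P. Q (\<eta> \<omega>)} = (\<Union>c\<in>{c \<in> ?R \<rightarrow>\<^sub>E UNIV. Q c}. ?E c)"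
  proof (intro equalityI subsetI)
    fix \<omega> assume "\<omega> \<in> {\<omega> \<in> space P. Q (\<eta> \<omega>)}"
    moreover have "Q (restrict (\<eta> \<omega>) ?R) = Q (\<eta> \<omega>)" by (rule Q) simp
    ultimately show "\<omega> \<in> (\<Union>c\<in>{c \<in> ?R \<rightarrow>\<^sub>E UNIV. Q c}. ?E c)"
      by (intro UN_I[of "restrict (\<eta> \<omega>) ?R"]) auto
  next
    fix \<omega> assume "\<omega> \<in> (\<Union>c\<in>{c \<in> ?R \<rightarrow>\<^sub>E UNIV. Q c}. ?E c)"
    then obtain c where "\<omega> \<in> space P" "Q c" "\<And>v. v \<in> ?R \<Longrightarrow> \<eta> \<omega> v = c v" by auto
    then show "\<omega> \<in> {\<omega> \<in> space P. Q (\<eta> \<omega>)}" using Q[of "\<eta> \<omega>" c] by auto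
  qed
  also have "prob \<dots> = (\<Sum>c\<in>{c \<in> ?R \<rightarrow>\<^sub>E UNIV. Q c}. prob (?E c))"
  proof (rule finite_measure_finite_Union)
    show "finite {c \<in> ?R \<rightarrow>\<^sub>E (UNIV :: (bool \<times> bool) set). Q c}"
      by (rule finite_subset[of _ "?R \<rightarrow>\<^sub>E UNIV"]) (auto intro!: finite_PiE)
    have "?E c \<in> events" for c
      by (rule sets_arrows) auto
    then show "?E ` {c \<in> ?R \<rightarrow>\<^sub>E UNIV. Q c} \<subseteq> events" by blast
    show "disjoint_family_on ?E {c \<in> ?R \<rightarrow>\<^sub>E UNIV. Q c}"
    proof (unfold disjoint_family_on_def, intro ballI impI)
      fix c c' assume c: "c \<in> {c \<in> ?R \<rightarrow>\<^sub>E UNIV. Q c}" "c' \<in> {c \<in> ?R \<rightarrow>\<^sub>E UNIV. Q c}" "c \<noteq> c'"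
      then obtain v where "v \<in> ?R" "c v \<noteq> c' v"
        using PiE_ext[of c ?R "\<lambda>_. UNIV" c'] by blast
      then show "?E c \<inter> ?E c' = {}" by fastforce
    qed
  qed
  also have "\<dots> = (\<Sum>c\<in>{c \<in> ?R \<rightarrow>\<^sub>E UNIV. Q c}. \<Prod>v\<in>?R. s6v_weight a q (s6v_in c v) (c v))"
  proof (rule sum.cong[OF refl])
    fix c
    show "prob (?E c) = (\<Prod>v\<in>?R. s6v_weight a q (s6v_in c v) (c v))"
      by (rule prob_lower_set[where n = "Suc (m + n)"]) (auto simp: assms lower_set_def s6v_below_def)
  qed
  finally show ?thesis .
qed

end

section \<open>Height functions on a rectangle\<close>

text \<open>\<open>G (x, y)\<close> is to count the paths crossing from column \<open>x\<close> to
  column \<open>x + 1\<close> in rows \<open>1\<close> to \<open>y\<close>. The values at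
  \<open>x = 0\<close> and \<open>y = 0\<close> encode the step initial condition; extensionality
  makes the correspondence with configurations one to one.\<close>

definition heights :: "nat \<Rightarrow> nat \<Rightarrow> (nat \<times> nat \<Rightarrow> int) set" where
  "heights m n = {G \<in> extensional ({..m} \<times> {..n}).
     (\<forall>y\<le>n. G (0, y) = int y) \<and> (\<forall>x\<le>m. G (x, 0) = 0) \<and>
     (\<forall>x<m. \<forall>y\<le>n. G (x, y) - G (Suc x, y) \<in> {0, 1}) \<and>
     (\<forall>x\<le>m. \<forall>y<n. G (x, Suc y) - G (x, y) \<in> {0, 1})}"

lemma heightsD:
  assumes "G \<in> heights m n"
  shows "y \<le> n \<Longrightarrow> G (0, y) = int y" "x \<le> m \<Longrightarrow> G (x, 0) = 0"
    "x < m \<Longrightarrow> y \<le> n \<Longrightarrow> G (x, y) = G (Suc x, y) \<or> G (x, y) = G (Suc x, y) + 1"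
    "x \<le> m \<Longrightarrow> y < n \<Longrightarrow> G (x, Suc y) = G (x, y) \<or> G (x, Suc y) = G (x, y) + 1"
    "G \<in> extensional ({..m} \<times> {..n})"
proof -
  show "x < m \<Longrightarrow> y \<le> n \<Longrightarrow> G (x, y) = G (Suc x, y) \<or> G (x, y) = G (Suc x, y) + 1"
    "x \<le> m \<Longrightarrow> y < n \<Longrightarrow> G (x, Suc y) = G (x, y) \<or> G (x, Suc y) = G (x, y) + 1"
    using assms unfolding heights_def by (simp_all add: diff_eq_eq add.commute)
qed (use assms in \<open>simp_all add: heights_def\<close>)

lemma heights_bounds:
  assumes G: "G \<in> heights m n" and "x \<le> m" "y \<le> n"
  shows "0 \<le> G (x, y)" "G (x, y) \<le> int y"
proof -
  show "0 \<le> G (x, y)"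
    using assms(3)
  proof (induction y)
    case 0
    then show ?case using heightsD(2)[OF G assms(2)] by simp
  next
    case (Suc y)
    then show ?case using heightsD(4)[OF G assms(2), of y] by auto
  qed
  show "G (x, y) \<le> int y"
    using assms(2)
  proof (induction x)
    case 0
    then show ?case using heightsD(1)[OF G assms(3)] by simp
  next
    case (Suc x)
    then show ?case using heightsD(3)[OF G, of x y] assms(3) by auto
  qed
qed

text \<open>The index \<open>(x, y)\<close> is the face to the lower left of the vertex
  \<open>(x + 1, y + 1)\<close>; an edge carries an arrow exactly if the heights on its two sides
  differ.\<close>

definition vertex_weight :: "real \<Rightarrow> real \<Rightarrow> (nat \<times> nat \<Rightarrow> int) \<Rightarrow> nat \<times> nat \<Rightarrow> real" where
  "vertex_weight a q G = (\<lambda>(x, y).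
     s6v_weight a q (G (x, y) \<noteq> G (Suc x, y), G (x, y) \<noteq> G (x, Suc y))
       (G (x, Suc y) \<noteq> G (Suc x, Suc y), G (Suc x, y) \<noteq> G (Suc x, Suc y)))"

definition height_weight :: "real \<Rightarrow> real \<Rightarrow> nat \<Rightarrow> nat \<Rightarrow> (nat \<times> nat \<Rightarrow> int) \<Rightarrow> real" where
  "height_weight a q m n G = (\<Prod>p\<in>{..<m} \<times> {..<n}. vertex_weight a q G p)"

text \<open>Incoming and outgoing arrows both add up to \<open>G (x, Suc y) - G (Suc x, y)\<close>,
  by way of the lower left and of the upper right face.\<close>

lemma conserved_heights:
  assumes "G \<in> heights m n" "x < m" "y < n"
  shows "conserved (G (x, y) \<noteq> G (Suc x, y), G (x, y) \<noteq> G (x, Suc y))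
    (G (x, Suc y) \<noteq> G (Suc x, Suc y), G (Suc x, y) \<noteq> G (Suc x, Suc y))"
proof -
  have step: "of_bool (k \<noteq> l) = \<bar>k - l\<bar>" if "k = l \<or> k = l + 1 \<or> l = k + 1" for k l :: int
    using that by auto
  have "of_bool (G (x, y) \<noteq> G (Suc x, y)) = G (x, y) - G (Suc x, y)"
    "of_bool (G (x, Suc y) \<noteq> G (Suc x, Suc y)) = G (x, Suc y) - G (Suc x, Suc y)"
    "of_bool (G (x, y) \<noteq> G (x, Suc y)) = G (x, Suc y) - G (x, y)"
    "of_bool (G (Suc x, y) \<noteq> G (Suc x, Suc y)) = G (Suc x, Suc y) - G (Suc x, y)"
    using heightsD(3)[OF assms(1), of x y] heightsD(3)[OF assms(1), of x "Suc y"]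
      heightsD(4)[OF assms(1), of x y] heightsD(4)[OF assms(1), of "Suc x" y] assms(2,3)
    by (subst step; force)+
  then show ?thesis
    unfolding conserved_def fst_conv snd_conv by linarith
qed

section \<open>Bijection between conserving configurations and height functions\<close>

definition flow :: "s6v_config \<Rightarrow> nat \<Rightarrow> nat \<Rightarrow> int" where
  "flow c x y = (\<Sum>j<y. of_bool (snd (s6v_in c (Suc x, Suc j))))"

text \<open>Counting incoming rather than outgoing arrows lets column \<open>0\<close> read the
  boundary, where every row brings one arrow.\<close>

lemma flow_0: "flow c 0 y = int y" "flow c x 0 = 0"
  by (simp_all add: flow_def s6v_in_def)

lemma flow_Suc: "flow c x (Suc y) = flow c x y + of_bool (snd (s6v_in c (Suc x, Suc y)))"
  by (simp add: flow_def)

definition conserving :: "nat \<Rightarrow> nat \<Rightarrow> s6v_config \<Rightarrow> bool" where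
  "conserving m n c \<longleftrightarrow> (\<forall>v\<in>{1..m} \<times> {1..n}. conserved (s6v_in c v) (c v))"

text \<open>Conservation at the vertex \<open>(Suc x, Suc y)\<close> carries the identity from below
  that vertex to above it.\<close>

lemma flow_step:
  assumes "conserving m n c" "x < m" "y \<le> n"
  shows "flow c x y - flow c (Suc x) y = of_bool (fst (s6v_in c (Suc x, Suc y)))"
  using assms(3)
proof (induction y)
  case 0
  then show ?case by (simp add: flow_0 s6v_in_def)
next
  case (Suc y)
  have "conserved (s6v_in c (Suc x, Suc y)) (c (Suc x, Suc y))"
    using assms(1,2) Suc.prems by (auto simp: conserving_def)
  moreover have "snd (s6v_in c (Suc (Suc x), Suc y)) = snd (c (Suc x, Suc y))"
    "fst (s6v_in c (Suc x, Suc (Suc y))) = fst (c (Suc x, Suc y))"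
    by (auto simp: s6v_in_def)
  ultimately show ?case
    using Suc.IH Suc.prems by (simp add: flow_Suc conserved_def)
qed

text \<open>At \<open>x = 0\<close> both sides equal \<open>n\<close>, and passing column
  \<open>Suc x\<close> lowers both by the vertical arrow that leaves \<open>(Suc x, n)\<close>. The
  shift to \<open>Suc x\<close> arises because the height at \<open>(M, N)\<close> looks at columns
  up to \<open>M - 1\<close>.\<close>

lemma s6v_height_eq_flow:
  assumes c: "conserving m n c" and "1 \<le> n" "x \<le> m"
  shows "s6v_height c (Suc x) n = flow c x n"
  using assms(3)
proof (induction x)
  case 0
  have "{x. 1 \<le> x \<and> x \<le> (0::nat) \<and> fst (c (x, n))} = {}" by auto
  then show ?case by (simp add: s6v_height_def flow_0)
next
  case (Suc x)
  let ?S = "\<lambda>k. {x. 1 \<le> x \<and> x \<le> k \<and> fst (c (x, n))}"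
  have fin: "finite (?S x)" by (rule finite_subset[of _ "{..x}"]) auto
  have "?S (Suc x) = (if fst (c (Suc x, n)) then insert (Suc x) (?S x) else ?S x)"
    by (auto simp: le_Suc_eq)
  then have "int (card (?S (Suc x))) = int (card (?S x)) + of_bool (fst (c (Suc x, n)))"
    using fin by simp
  moreover have "fst (s6v_in c (Suc x, Suc n)) = fst (c (Suc x, n))"
    using assms(2) by (simp add: s6v_in_def)
  then have "flow c x n - flow c (Suc x) n = of_bool (fst (c (Suc x, n)))"
    using flow_step[OF c, of x n] Suc.prems by simp
  ultimately show ?case
    using Suc by (simp add: s6v_height_def)
qed

definition flow_heights :: "nat \<Rightarrow> nat \<Rightarrow> s6v_config \<Rightarrow> nat \<times> nat \<Rightarrow> int" where
  "flow_heights m n c = restrict (\<lambda>(x, y). flow c x y) ({..m} \<times> {..n})"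

lemma flow_heights_in_heights:
  assumes "conserving m n c"
  shows "flow_heights m n c \<in> heights m n"
proof -
  have "flow c x y - flow c (Suc x) y \<in> {0, 1}" if "x < m" "y \<le> n" for x y
    using flow_step[OF assms that] by simp
  then show ?thesis
    by (auto simp: heights_def flow_heights_def flow_0 flow_Suc)
qed

text \<open>The inverse of \<open>flow_heights\<close> on conserving extensional configurations:
  outgoing arrows are read off from the heights.\<close>

definition config_of :: "nat \<Rightarrow> nat \<Rightarrow> (nat \<times> nat \<Rightarrow> int) \<Rightarrow> s6v_config" where
  "config_of m n G =
     restrict (\<lambda>(x, y). (G (x - 1, y) \<noteq> G (x, y), G (x, y - 1) \<noteq> G (x, y))) ({1..m} \<times> {1..n})"

lemma snd_s6v_in_config_of:
  assumes "G \<in> heights m n" "x \<le> m" "y < n"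
  shows "snd (s6v_in (config_of m n G) (Suc x, Suc y)) \<longleftrightarrow> G (x, y) \<noteq> G (x, Suc y)"
  using assms heightsD(1)[OF assms(1), of y] heightsD(1)[OF assms(1), of "Suc y"]
  by (cases x) (auto simp: s6v_in_def config_of_def)

lemma s6v_in_config_of:
  assumes "G \<in> heights m n" "x < m" "y < n"
  shows "s6v_in (config_of m n G) (Suc x, Suc y)
    = (G (x, y) \<noteq> G (Suc x, y), G (x, y) \<noteq> G (x, Suc y))"
proof (rule prod_eqI)
  show "fst (s6v_in (config_of m n G) (Suc x, Suc y))
      = fst (G (x, y) \<noteq> G (Suc x, y), G (x, y) \<noteq> G (x, Suc y))"
    using assms heightsD(2)[OF assms(1), of x] heightsD(2)[OF assms(1), of "Suc x"]
    by (cases y) (auto simp: s6v_in_def config_of_def)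
qed (use snd_s6v_in_config_of[OF assms(1), of x y] assms in simp)

lemma flow_config_of:
  assumes "G \<in> heights m n" "x \<le> m" "y \<le> n"
  shows "flow (config_of m n G) x y = G (x, y)"
  using assms(3)
proof (induction y)
  case 0
  then show ?case using heightsD(2)[OF assms(1,2)] by (simp add: flow_0)
next
  case (Suc y)
  then show ?case
    using snd_s6v_in_config_of[OF assms(1,2), of y] heightsD(4)[OF assms(1,2), of y]
    by (auto simp: flow_Suc)
qed

lemma image_Suc_box: "{1..m} \<times> {1..n} = map_prod Suc Suc ` ({..<m} \<times> {..<n})"
  by (simp add: map_prod_surj_on image_Suc_lessThan)

lemma conserving_config_of:
  assumes "G \<in> heights m n"
  shows "conserving m n (config_of m n G)"
  unfolding conserving_def image_Suc_box
  using conserved_heights[OF assms] s6v_in_config_of[OF assms] by (auto simp: config_of_def)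

lemma config_of_flow_heights:
  assumes "conserving m n c" "c \<in> ({1..m} \<times> {1..n}) \<rightarrow>\<^sub>E UNIV"
  shows "config_of m n (flow_heights m n c) = c"
proof (rule PiE_ext[of _ "{1..m} \<times> {1..n}" "\<lambda>_. UNIV"])
  show "config_of m n (flow_heights m n c) \<in> ({1..m} \<times> {1..n}) \<rightarrow>\<^sub>E UNIV"
    by (auto simp: config_of_def)
  fix v assume "v \<in> {1..m} \<times> {1..n}"
  then obtain x y where v: "v = (Suc x, Suc y)" and xy: "x < m" "y < n"
    unfolding image_Suc_box by auto
  have "flow c x (Suc y) \<noteq> flow c (Suc x) (Suc y) \<longleftrightarrow> fst (s6v_in c (Suc x, Suc (Suc y)))"
    using flow_step[OF assms(1), of x "Suc y"] xy
    by (cases "fst (s6v_in c (Suc x, Suc (Suc y)))") auto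
  moreover have "flow c (Suc x) y \<noteq> flow c (Suc x) (Suc y) \<longleftrightarrow> snd (s6v_in c (Suc (Suc x), Suc y))"
    by (simp add: flow_Suc)
  ultimately show "config_of m n (flow_heights m n c) v = c v"
    using xy by (simp add: config_of_def flow_heights_def v s6v_in_def)
qed (use assms in auto)

lemma flow_heights_config_of:
  assumes "G \<in> heights m n"
  shows "flow_heights m n (config_of m n G) = G"
proof
  fix p
  show "flow_heights m n (config_of m n G) p = G p"
    using flow_config_of[OF assms] extensional_arb[OF heightsD(5)[OF assms], of p]
    by (cases p) (auto simp: flow_heights_def restrict_def)
qed

lemma finite_heights: "finite (heights m n)"
proof (rule finite_subset)
  show "heights m n \<subseteq> flow_heights m n ` (({1..m} \<times> {1..n}) \<rightarrow>\<^sub>E UNIV)"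
  proof
    fix G assume "G \<in> heights m n"
    then have "G = flow_heights m n (config_of m n G)"
      by (simp add: flow_heights_config_of)
    moreover have "config_of m n G \<in> ({1..m} \<times> {1..n}) \<rightarrow>\<^sub>E UNIV"
      by (simp add: config_of_def)
    ultimately show "G \<in> flow_heights m n ` (({1..m} \<times> {1..n}) \<rightarrow>\<^sub>E UNIV)"
      by (rule image_eqI)
  qed
qed (intro finite_imageI finite_PiE; simp)

lemma prod_weight_config_of:
  assumes "G \<in> heights m n"
  shows "(\<Prod>v\<in>{1..m} \<times> {1..n}. s6v_weight a q (s6v_in (config_of m n G) v) (config_of m n G v))
    = height_weight a q m n G"
proof -
  have inj: "inj_on (map_prod Suc Suc) ({..<m} \<times> {..<n})"
    by (auto intro: inj_onI)
  show ?thesis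
    unfolding height_weight_def image_Suc_box prod.reindex[OF inj]
  proof (rule prod.cong[OF refl])
    fix p assume "p \<in> {..<m} \<times> {..<n}"
    then obtain x y where p: "p = (x, y)" "x < m" "y < n" by auto
    then have "config_of m n G (Suc x, Suc y)
        = (G (x, Suc y) \<noteq> G (Suc x, Suc y), G (Suc x, y) \<noteq> G (Suc x, Suc y))"
      by (simp add: config_of_def)
    then show "((\<lambda>v. s6v_weight a q (s6v_in (config_of m n G) v) (config_of m n G v))
        \<circ> map_prod Suc Suc) p
        = vertex_weight a q G p"
      using p by (simp add: s6v_in_config_of[OF assms] vertex_weight_def)
  qed
qed

text \<open>Configurations that violate conservation have weight 0; the others correspond one to one
  to height functions, with the same weight and corner height.\<close>

lemma (in stochastic_six_vertex) prob_height_ge: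
  assumes "a * q \<noteq> 1" "1 \<le> n"
  shows "prob {\<omega> \<in> space P. r \<le> real_of_int (s6v_height (\<eta> \<omega>) (Suc m) n)}
    = (\<Sum>G | G \<in> heights m n \<and> r \<le> real_of_int (G (m, n)). height_weight a q m n G)"
proof -
  let ?R = "{1..m} \<times> {1..n}"
  let ?Q = "\<lambda>c. r \<le> real_of_int (s6v_height c (Suc m) n)"
  let ?w = "\<lambda>c. \<Prod>v\<in>?R. s6v_weight a q (s6v_in c v) (c v)"
  let ?A = "{c \<in> ?R \<rightarrow>\<^sub>E UNIV. ?Q c}"
  have "prob {\<omega> \<in> space P. ?Q (\<eta> \<omega>)} = sum ?w ?A"
  proof (rule prob_rectangle[OF assms(1)])
    fix c c' :: s6v_config assume "\<And>v. v \<in> ?R \<Longrightarrow> c v = c' v"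
    then have "{x. 1 \<le> x \<and> x \<le> m \<and> fst (c (x, n))} = {x. 1 \<le> x \<and> x \<le> m \<and> fst (c' (x, n))}"
      using assms(2) by auto
    then show "?Q c = ?Q c'" by (simp add: s6v_height_def)
  qed
  also have "\<dots> = sum ?w {c \<in> ?A. conserving m n c}"
  proof (rule sum.mono_neutral_right)
    show "finite ?A"
      by (rule finite_subset[of _ "?R \<rightarrow>\<^sub>E UNIV"]) (auto intro!: finite_PiE)
    show "\<forall>c\<in>?A - {c \<in> ?A. conserving m n c}. ?w c = 0"
    proof
      fix c assume "c \<in> ?A - {c \<in> ?A. conserving m n c}"
      then obtain v where "v \<in> ?R" "\<not> conserved (s6v_in c v) (c v)"
        by (auto simp: conserving_def)
      then show "?w c = 0" by (intro prod_zero) (auto intro: weight_eq_0)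
    qed
  qed auto
  also have "\<dots> = (\<Sum>G | G \<in> heights m n \<and> r \<le> real_of_int (G (m, n)). height_weight a q m n G)"
  proof (rule sum.reindex_bij_witness[of _ "config_of m n" "flow_heights m n"])
    fix c assume "c \<in> {c \<in> ?A. conserving m n c}"
    then have c: "conserving m n c" "c \<in> ?R \<rightarrow>\<^sub>E UNIV" "?Q c" by blast+
    from c(1,2) show inv: "config_of m n (flow_heights m n c) = c"
      by (rule config_of_flow_heights)
    from c(1) have G: "flow_heights m n c \<in> heights m n"
      by (rule flow_heights_in_heights)
    then show "flow_heights m n c \<in> {G \<in> heights m n. r \<le> real_of_int (G (m, n))}"
      using c s6v_height_eq_flow[of m n c m] assms(2) by (simp add: flow_heights_def)
    show "height_weight a q m n (flow_heights m n c) = ?w c"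
      using prod_weight_config_of[OF G] by (simp only: inv)
  next
    fix G assume "G \<in> {G \<in> heights m n. r \<le> real_of_int (G (m, n))}"
    then have G: "G \<in> heights m n" "r \<le> real_of_int (G (m, n))" by auto
    show "flow_heights m n (config_of m n G) = G"
      using G by (simp add: flow_heights_config_of)
    have "config_of m n G \<in> ?R \<rightarrow>\<^sub>E UNIV" by (simp add: config_of_def)
    moreover have "?Q (config_of m n G)"
      using G s6v_height_eq_flow[OF conserving_config_of[OF G(1)] assms(2) order_refl]
      by (simp add: flow_config_of)
    ultimately show "config_of m n G \<in> {c \<in> ?A. conserving m n c}"
      using conserving_config_of[OF G(1)] by blast
  qed
  finally show ?thesis .
qed

section \<open>Exchanging two height functions on a cluster\<close>

definition adjacent :: "nat \<times> nat \<Rightarrow> nat \<times> nat \<Rightarrow> bool" where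
  "adjacent p q \<longleftrightarrow> (fst p = fst q \<and> (snd p = Suc (snd q) \<or> snd q = Suc (snd p))) \<or>
     (snd p = snd q \<and> (fst p = Suc (fst q) \<or> fst q = Suc (fst p)))"

lemma adjacent_sym: "adjacent p q \<Longrightarrow> adjacent q p"
  by (auto simp: adjacent_def)

text \<open>The origin belongs to its cluster even when it lies outside \<open>Z\<close>, and is
  then alone in it. This is harmless below, since the exchange does nothing on the level
  set.\<close>

inductive_set cluster :: "(nat \<times> nat) set \<Rightarrow> nat \<times> nat \<Rightarrow> (nat \<times> nat) set" for Z c where
  origin: "c \<in> cluster Z c"
| step: "p \<in> cluster Z c \<Longrightarrow> p \<in> Z \<Longrightarrow> q \<in> Z \<Longrightarrow> adjacent p q \<Longrightarrow> q \<in> cluster Z c"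

definition swap_sites where
  "swap_sites m n d G1 G2 = cluster {p \<in> {..m} \<times> {..n}. G1 p - G2 p \<noteq> (d::int)} (m, n)"

definition swap ::
    "nat \<Rightarrow> nat \<Rightarrow> int \<Rightarrow> (nat \<times> nat \<Rightarrow> int) \<times> (nat \<times> nat \<Rightarrow> int)
      \<Rightarrow> (nat \<times> nat \<Rightarrow> int) \<times> (nat \<times> nat \<Rightarrow> int)" where
  "swap m n d = (\<lambda>(G1, G2).
     (\<lambda>p. if p \<in> swap_sites m n d G1 G2 then G2 p + d else G1 p,
      \<lambda>p. if p \<in> swap_sites m n d G1 G2 then G1 p - d else G2 p))"

lemma swap_sites_subset: "swap_sites m n d G1 G2 \<subseteq> {..m} \<times> {..n}"
proof
  fix p assume "p \<in> swap_sites m n d G1 G2"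
  then show "p \<in> {..m} \<times> {..n}"
    unfolding swap_sites_def by (induction rule: cluster.induct) auto
qed

lemma corner_in_swap_sites: "(m, n) \<in> swap_sites m n d G1 G2"
  unfolding swap_sites_def by (rule cluster.origin)

lemma swap_sites_adjacent:
  assumes "adjacent p q" "p \<in> {..m} \<times> {..n}" "q \<in> {..m} \<times> {..n}"
    and "G1 p - G2 p \<noteq> d" "G1 q - G2 q \<noteq> d"
  shows "p \<in> swap_sites m n d G1 G2 \<longleftrightarrow> q \<in> swap_sites m n d G1 G2"
  unfolding swap_sites_def
  using assms cluster.step[of p _ _ q] cluster.step[of q _ _ p] adjacent_sym by blast

text \<open>
  The swap turns \<open>G1 - G2 - d\<close> into its negative on the cluster, so the zero set of this function,
  and with it the cluster, is the same for the swapped pair.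
\<close>

lemma swap_swap: "swap m n d (swap m n d GG) = GG"
proof -
  obtain G1 G2 where GG: "GG = (G1, G2)" by (cases GG)
  obtain H1 H2 where H: "swap m n d (G1, G2) = (H1, H2)" by (cases "swap m n d (G1, G2)")
  let ?U = "swap_sites m n d G1 G2"
  have H1: "H1 = (\<lambda>p. if p \<in> ?U then G2 p + d else G1 p)"
    and H2: "H2 = (\<lambda>p. if p \<in> ?U then G1 p - d else G2 p)"
    using H by (simp_all add: swap_def)
  have "H1 p - H2 p = d \<longleftrightarrow> G1 p - G2 p = d" for p
    by (auto simp: H1 H2)
  then have "swap_sites m n d H1 H2 = ?U"
    by (simp add: swap_sites_def)
  then show ?thesis
    unfolding GG H by (auto simp: swap_def H1 H2)
qed

section \<open>The exchange for one pair of height functions\<close>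

locale height_pair =
  fixes m n :: nat and d :: int and G1 G2 H1 H2
  assumes G1: "G1 \<in> heights m n" and G2: "G2 \<in> heights m n"
    and d: "0 < d" "d \<le> G1 (m, n) - G2 (m, n)"
    and H: "swap m n d (G1, G2) = (H1, H2)"
begin

abbreviation "U \<equiv> swap_sites m n d G1 G2"

definition "kept p \<longleftrightarrow> H1 p = G1 p \<and> H2 p = G2 p"

definition "swapped p \<longleftrightarrow> H1 p = G2 p + d \<and> H2 p = G1 p - d"

lemma kept: "p \<notin> U \<Longrightarrow> kept p" and swapped: "p \<in> U \<Longrightarrow> swapped p"
  using H by (auto simp: swap_def kept_def swapped_def)

text \<open>On the level set \<open>G2 p + d\<close> equals \<open>G1 p\<close>, so a site there
  counts as kept and as swapped and can be joined to either side.\<close>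

lemma kept_swapped: "G1 p - G2 p = d \<Longrightarrow> kept p \<and> swapped p"
  using H by (auto simp: swap_def kept_def swapped_def)

text \<open>Off the level set neighbours share their status; a site on the level set adopts the
  status of its neighbour.\<close>

lemma adjacent_kept_or_swapped:
  assumes "adjacent p q" "p \<in> {..m} \<times> {..n}" "q \<in> {..m} \<times> {..n}"
  shows "kept p \<and> kept q \<or> swapped p \<and> swapped q"
  using swap_sites_adjacent[OF assms, of G1 G2 d] kept swapped kept_swapped by metis

lemma diff_step:
  assumes "adjacent p q" "p \<in> {..m} \<times> {..n}" "q \<in> {..m} \<times> {..n}"
  shows "\<bar>(G1 p - G2 p) - (G1 q - G2 q)\<bar> \<le> 1"
proof -
  have x: "\<bar>(G1 (x, y) - G2 (x, y)) - (G1 (Suc x, y) - G2 (Suc x, y))\<bar> \<le> 1"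
    if "x < m" "y \<le> n" for x y
    using heightsD(3)[OF G1 that] heightsD(3)[OF G2 that] by (elim disjE) simp_all
  have y: "\<bar>(G1 (x, y) - G2 (x, y)) - (G1 (x, Suc y) - G2 (x, Suc y))\<bar> \<le> 1"
    if "x \<le> m" "y < n" for x y
    using heightsD(4)[OF G1 that] heightsD(4)[OF G2 that] by (elim disjE) simp_all
  obtain x' y' x'' y'' where pq: "p = (x', y')" "q = (x'', y'')" by (cases p, cases q)
  from assms(1) consider "x'' = x'" "y'' = Suc y'" | "x'' = x'" "y' = Suc y''"
    | "y'' = y'" "x'' = Suc x'" | "y'' = y'" "x' = Suc x''"
    unfolding adjacent_def pq by auto
  then show ?thesis
  proof cases
    case 1
    then show ?thesis using assms y[of x' y'] by (simp add: pq)
  next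
    case 2
    then show ?thesis using assms y[of x' y''] by (simp add: pq abs_minus_commute)
  next
    case 3
    then show ?thesis using assms x[of x' y'] by (simp add: pq)
  next
    case 4
    then show ?thesis using assms x[of x'' y'] by (simp add: pq abs_minus_commute)
  qed
qed

text \<open>The cluster grows only from sites where the difference is not \<open>d\<close>, hence
  above \<open>d\<close>, and one step changes it by at most 1: it cannot pass below
  \<open>d\<close>.\<close>

lemma diff_ge_on_U: "p \<in> U \<Longrightarrow> d \<le> G1 p - G2 p"
  unfolding swap_sites_def
proof (induction rule: cluster.induct)
  case origin
  show ?case by (rule d(2))
next
  case (step p q)
  then have "d < G1 p - G2 p" by auto
  moreover have "\<bar>(G1 p - G2 p) - (G1 q - G2 q)\<bar> \<le> 1"
    using step(2-4) by (intro diff_step) auto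
  ultimately show ?case by simp
qed

text \<open>Both height functions have the same prescribed values there, so their difference is
  \<open>0 < d\<close> and the cluster stays away.\<close>

lemma kept_boundary:
  assumes "p \<in> {..m} \<times> {..n}" "fst p = 0 \<or> snd p = 0"
  shows "kept p"
proof (rule kept)
  have "G1 p = G2 p"
    using assms heightsD(1,2)[OF G1] heightsD(1,2)[OF G2] by (cases p) auto
  then show "p \<notin> U"
    using diff_ge_on_U[of p] d(1) by auto
qed

text \<open>As neighbours are kept together or swapped together, the constant \<open>d\<close>
  cancels and each increment of \<open>H1\<close> or \<open>H2\<close> is one of \<open>G1\<close>
  or \<open>G2\<close>. Boundary values and values outside the rectangle are kept.\<close>

lemma swap_heights: "H1 \<in> heights m n" "H2 \<in> heights m n"
proof -
  have ext: "H1 p = undefined \<and> H2 p = undefined" if "p \<notin> {..m} \<times> {..n}" for p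
    using that kept[of p] swap_sites_subset[of m n d G1 G2]
      extensional_arb[OF heightsD(5)[OF G1] that] extensional_arb[OF heightsD(5)[OF G2] that]
    by (auto simp: kept_def)
  have bd: "H1 (0, y) = int y \<and> H2 (0, y) = int y" if "y \<le> n" for y
    using kept_boundary[of "(0, y)"] heightsD(1)[OF G1 that] heightsD(1)[OF G2 that] that
    by (simp add: kept_def)
  have bd': "H1 (x, 0) = 0 \<and> H2 (x, 0) = 0" if "x \<le> m" for x
    using kept_boundary[of "(x, 0)"] heightsD(2)[OF G1 that] heightsD(2)[OF G2 that] that
    by (simp add: kept_def)
  have dx: "H1 (x, y) - H1 (Suc x, y) \<in> {0, 1} \<and> H2 (x, y) - H2 (Suc x, y) \<in> {0, 1}"
    if "x < m" "y \<le> n" for x y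
    using adjacent_kept_or_swapped[of "(x, y)" "(Suc x, y)"] that
      heightsD(3)[OF G1 that] heightsD(3)[OF G2 that]
    by (auto simp: adjacent_def kept_def swapped_def)
  have dy: "H1 (x, Suc y) - H1 (x, y) \<in> {0, 1} \<and> H2 (x, Suc y) - H2 (x, y) \<in> {0, 1}"
    if "x \<le> m" "y < n" for x y
    using adjacent_kept_or_swapped[of "(x, y)" "(x, Suc y)"] that
      heightsD(4)[OF G1 that] heightsD(4)[OF G2 that]
    by (auto simp: adjacent_def kept_def swapped_def)
  show "H1 \<in> heights m n" "H2 \<in> heights m n"
    unfolding heights_def extensional_def using ext bd bd' dx dy by blast+
qed

lemma swap_corner: "H1 (m, n) = G2 (m, n) + d" "H2 (m, n) = G1 (m, n) - d"
  using swapped[OF corner_in_swap_sites] by (simp_all add: swapped_def)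

text \<open>The two lower faces are adjacent and off the level set, so they share their status; each
  upper face shares it too or lies on the level set. Hence all four faces are kept or all are
  swapped, and as weights depend only on height differences, the two factors at most trade
  places.\<close>

lemma vertex_weight_swap:
  assumes "x < m" "y < n" "G1 (x, y) - G2 (x, y) \<noteq> d" "G1 (Suc x, y) - G2 (Suc x, y) \<noteq> d"
  shows "vertex_weight a q H1 (x, y) * vertex_weight a q H2 (x, y)
    = vertex_weight a q G1 (x, y) * vertex_weight a q G2 (x, y)"
proof -
  let ?S = "{(x, y), (Suc x, y), (x, Suc y), (Suc x, Suc y)}"
  have status: "r \<in> U \<longleftrightarrow> p \<in> U" if "adjacent p r" "p \<in> {(x, y), (Suc x, y)}" "r \<in> ?S"
    "G1 r - G2 r \<noteq> d" for p r
    by (rule swap_sites_adjacent[OF adjacent_sym]) (use that assms in auto)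
  have bottom: "(Suc x, y) \<in> U \<longleftrightarrow> (x, y) \<in> U"
    by (rule status) (use assms in \<open>auto simp: adjacent_def\<close>)
  have adj: "adjacent (x, y) (x, Suc y)" "adjacent (Suc x, y) (Suc x, Suc y)"
    by (auto simp: adjacent_def)
  have S: "G1 r - G2 r = d \<or> (r \<in> U \<longleftrightarrow> (x, y) \<in> U)" if "r \<in> ?S" for r
    using that bottom status[OF adj(1)] status[OF adj(2)] by auto
  show ?thesis
  proof (cases "(x, y) \<in> U")
    case True
    then have "swapped r" if "r \<in> ?S" for r
      using S[OF that] swapped kept_swapped by blast
    then show ?thesis
      by (simp add: swapped_def vertex_weight_def mult.commute)
  next
    case False
    then have "kept r" if "r \<in> ?S" for r
      using S[OF that] kept kept_swapped by blast
    then show ?thesis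
      by (simp add: kept_def vertex_weight_def)
  qed
qed

end

text \<open>
  The vertex \<open>(x, y)\<close> keeps its weights under the swap unless \<open>G1 - G2 = d\<close> at one of its
  two lower faces.
\<close>

definition interface :: "nat \<Rightarrow> nat \<Rightarrow> int \<Rightarrow> (nat \<times> nat \<Rightarrow> int) \<Rightarrow> (nat \<times> nat \<Rightarrow> int) \<Rightarrow> (nat \<times> nat) set" where
  "interface m n d G1 G2 = {(x, y) \<in> {..<m} \<times> {..<n}.
     G1 (x, y) - G2 (x, y) = d \<or> G1 (Suc x, y) - G2 (Suc x, y) = d}"

lemma vertex_weight_bounds:
  assumes "0 < a" "a < 1" "0 < q" "q < 1" "G \<in> heights m n" "p \<in> {..<m} \<times> {..<n}"
  shows "a * q * (1 - a) * (1 - q) / (1 - a * q)^2 \<le> vertex_weight a q G p"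
    and "vertex_weight a q G p \<le> 1"
    and "0 < vertex_weight a q G p"
  using weight_bounds[OF assms(1-4) conserved_heights[OF assms(5)]] assms(6)
  by (auto simp: vertex_weight_def)

text \<open>Off the interface the factors agree. On it the old product is at most 1 and the new one
  at least \<open>\<delta>^2\<close>, so each interface vertex costs at most
  \<open>1 / \<delta>^2\<close>.\<close>

lemma (in height_pair) height_weight_swap:
  assumes aq: "0 < a" "a < 1" "0 < q" "q < 1"
  defines "\<delta> \<equiv> a * q * (1 - a) * (1 - q) / (1 - a * q)^2"
  shows "height_weight a q m n G1 * height_weight a q m n G2
    \<le> (1 / \<delta>^2) ^ card (interface m n d G1 G2) * (height_weight a q m n H1 * height_weight a q m n H2)"
proof -
  let ?B = "{..<m} \<times> {..<n}" and ?Z = "interface m n d G1 G2" and ?C = "1 / \<delta>^2"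
  note wb = vertex_weight_bounds[OF aq]
  have "a * q < 1" using aq mult_strict_mono[of a 1 q 1] by simp
  then have \<delta>: "0 < \<delta>" using aq by (simp add: \<delta>_def)
  have "height_weight a q m n G1 * height_weight a q m n G2
      = (\<Prod>p\<in>?B. vertex_weight a q G1 p * vertex_weight a q G2 p)"
    by (simp add: height_weight_def prod.distrib)
  also have "\<dots> \<le> (\<Prod>p\<in>?B. (if p \<in> ?Z then ?C else 1)
      * (vertex_weight a q H1 p * vertex_weight a q H2 p))"
  proof (rule prod_mono, rule conjI)
    fix p assume p: "p \<in> ?B"
    show "0 \<le> vertex_weight a q G1 p * vertex_weight a q G2 p"
      using wb(3)[OF G1 p] wb(3)[OF G2 p] by simp
    show "vertex_weight a q G1 p * vertex_weight a q G2 p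
        \<le> (if p \<in> ?Z then ?C else 1) * (vertex_weight a q H1 p * vertex_weight a q H2 p)"
    proof (cases "p \<in> ?Z")
      case True
      have "vertex_weight a q G1 p * vertex_weight a q G2 p \<le> 1"
        using wb(2,3)[OF G1 p] wb(2,3)[OF G2 p] by (intro mult_le_one) auto
      moreover have "\<delta>^2 \<le> vertex_weight a q H1 p * vertex_weight a q H2 p"
        unfolding power2_eq_square
        using wb(1)[OF swap_heights(1) p] wb(1)[OF swap_heights(2) p] \<delta>
        unfolding \<delta>_def[symmetric] by (intro mult_mono) auto
      then have "1 \<le> ?C * (vertex_weight a q H1 p * vertex_weight a q H2 p)"
        using \<delta> by (simp add: pos_le_divide_eq)
      ultimately show ?thesis using True by simp
    next
      case False
      then show ?thesis
        using p vertex_weight_swap[of "fst p" "snd p" a q] by (cases p) (auto simp: interface_def)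
    qed
  qed
  also have "\<dots> = (\<Prod>p\<in>?B. if p \<in> ?Z then ?C else 1)
      * (height_weight a q m n H1 * height_weight a q m n H2)"
    by (simp add: height_weight_def prod.distrib)
  also have "(\<Prod>p\<in>?B. if p \<in> ?Z then ?C else 1) = (\<Prod>p\<in>?B \<inter> ?Z. ?C)"
    by (rule prod.inter_restrict[symmetric]) simp
  also have "?B \<inter> ?Z = ?Z"
    by (auto simp: interface_def)
  finally show ?thesis by (simp del: power_divide)
qed

section \<open>Pigeonhole over the level sets\<close>

lemma sum_card_level_le:
  assumes "finite D" "finite B"
  shows "(\<Sum>d\<in>D. card {p \<in> B. f p = d}) \<le> card B"
proof -
  have "(\<Sum>d\<in>D. card {p \<in> B. f p = d}) = card (\<Union>d\<in>D. {p \<in> B. f p = d})"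
    using assms by (intro card_UN_disjoint[symmetric]) auto
  also have "\<dots> \<le> card B"
    using assms by (intro card_mono) auto
  finally show ?thesis .
qed

text \<open>Each vertex has two lower faces and so lies in the interface for at most two values of
  \<open>d\<close>; the sizes add up to at most \<open>2 * (m * n)\<close>, and some
  \<open>d\<close> is no worse than average.\<close>

lemma small_interface:
  assumes "finite D" "D \<noteq> {}"
  shows "\<exists>d\<in>D. card D * card (interface m n d G1 G2) \<le> 2 * (m * n)"
proof (rule ccontr)
  let ?B = "{..<m} \<times> {..<n}"
  let ?f = "\<lambda>(x, y). G1 (x, y) - G2 (x, y)" and ?g = "\<lambda>(x, y). G1 (Suc x, y) - G2 (Suc x, y)"
  assume "\<not> ?thesis"
  then have "(\<Sum>d\<in>D. 2 * (m * n)) < (\<Sum>d\<in>D. card D * card (interface m n d G1 G2))"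
    using assms by (intro sum_strict_mono) auto
  then have "card D * (2 * (m * n)) < card D * (\<Sum>d\<in>D. card (interface m n d G1 G2))"
    by (simp add: sum_distrib_left)
  then have "2 * (m * n) < (\<Sum>d\<in>D. card (interface m n d G1 G2))"
    by simp
  also have "\<dots> \<le> (\<Sum>d\<in>D. card {p \<in> ?B. ?f p = d} + card {p \<in> ?B. ?g p = d})"
  proof (rule sum_mono)
    fix d
    have "interface m n d G1 G2 = {p \<in> ?B. ?f p = d} \<union> {p \<in> ?B. ?g p = d}"
      by (auto simp: interface_def)
    then show "card (interface m n d G1 G2) \<le> card {p \<in> ?B. ?f p = d} + card {p \<in> ?B. ?g p = d}"
      by (simp add: card_Un_le)
  qed
  also have "\<dots> \<le> card ?B + card ?B"
    unfolding sum.distrib using assms(1) by (intro add_mono sum_card_level_le) auto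
  finally show False by simp
qed

section \<open>Weak log-concavity\<close>

text \<open>By \<open>prob_height_ge\<close> this is the probability that the height at
  \<open>(Suc m, n)\<close> is at least \<open>r\<close>.\<close>

definition tail_weight :: "real \<Rightarrow> real \<Rightarrow> nat \<Rightarrow> nat \<Rightarrow> real \<Rightarrow> real" where
  "tail_weight a q m n r
     = (\<Sum>G | G \<in> heights m n \<and> r \<le> real_of_int (G (m, n)). height_weight a q m n G)"

text \<open>\<open>r1 + r2 - 2 * t - 1\<close> bounds from below the number of admissible
  \<open>d\<close>, so \<open>K\<close> bounds the smallest interface. Each pair is sent to a record
  \<open>(d, H1, H2)\<close> from which it can be recovered.\<close>

lemma tail_weight_mult_le:
  assumes aq: "0 < a" "a < 1" "0 < q" "q < 1"
    and n: "1 \<le> n" and "t \<le> r1"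
    and L: "0 < r1 + r2 - 2 * t - 1" and K: "2 * real (m * n) \<le> (r1 + r2 - 2 * t - 1) * K"
  defines "\<delta> \<equiv> a * q * (1 - a) * (1 - q) / (1 - a * q)^2"
  shows "tail_weight a q m n r1 * tail_weight a q m n r2
    \<le> real n * (1 / \<delta>^2) powr K * (tail_weight a q m n t)^2"
proof -
  let ?C = "1 / \<delta>^2" and ?W = "height_weight a q m n"
  let ?T = "\<lambda>r. {G \<in> heights m n. r \<le> real_of_int (G (m, n))}"
  have fin: "finite (?T r)" for r
    by (rule finite_subset[OF _ finite_heights]) auto
  have "a * q < 1" using aq mult_strict_mono[of a 1 q 1] by simp
  then have \<delta>: "0 < \<delta>" using aq by (simp add: \<delta>_def)
  have "\<delta> \<le> 1"
    using weight_bounds(1)[OF aq, of "(False, False)" "(False, False)"]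
    by (simp add: \<delta>_def conserved_def)
  with \<delta> have C: "1 \<le> ?C" by (simp add: power_le_one)
  have "0 \<le> (r1 + r2 - 2 * t - 1) * K"
    by (rule order_trans[OF _ K]) simp
  then have K0: "0 \<le> K" using L by (simp add: zero_le_mult_iff)
  have W0: "0 \<le> ?W G" if "G \<in> heights m n" for G
    unfolding height_weight_def using vertex_weight_bounds(3)[OF aq that]
    by (intro prod_nonneg) (auto intro: less_imp_le)
  \<comment> \<open>\<open>\<Phi>\<close> recovers the pair from its record. Genuine exchanges have
    \<open>d > 0\<close>, so \<open>d = 0\<close> is free to mark a pair left alone. All records
    have \<open>0 \<le> d < n\<close>, whence the factor \<open>n\<close>.\<close>
  define \<Phi> where "\<Phi> = (\<lambda>(d, GG). if d = 0 then GG else swap m n d GG)"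
  have product: "tail_weight a q m n r * tail_weight a q m n r'
      = (\<Sum>(G1, G2)\<in>?T r \<times> ?T r'. ?W G1 * ?W G2)" for r r'
    by (simp only: tail_weight_def sum_product sum.cartesian_product)
  have "tail_weight a q m n r1 * tail_weight a q m n r2
      = (\<Sum>(G1, G2)\<in>?T r1 \<times> ?T r2. ?W G1 * ?W G2)"
    by (rule product)
  also have "\<dots> \<le> (\<Sum>(d, H1, H2)\<in>{0..<int n} \<times> ?T t \<times> ?T t. ?C powr K * (?W H1 * ?W H2))"
  proof (rule sum_le_included[where i = \<Phi>])
    show "\<forall>y\<in>{0..<int n} \<times> ?T t \<times> ?T t.
        0 \<le> (case y of (d, H1, H2) \<Rightarrow> ?C powr K * (?W H1 * ?W H2))"
      using W0 by (auto intro!: mult_nonneg_nonneg)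
    show "\<forall>x\<in>?T r1 \<times> ?T r2. \<exists>y\<in>{0..<int n} \<times> ?T t \<times> ?T t. \<Phi> y = x \<and>
        (case x of (G1, G2) \<Rightarrow> ?W G1 * ?W G2)
          \<le> (case y of (d, H1, H2) \<Rightarrow> ?C powr K * (?W H1 * ?W H2))"
    proof safe
      fix G1 G2
      assume G: "G1 \<in> heights m n" "G2 \<in> heights m n"
        and r: "r1 \<le> real_of_int (G1 (m, n))" "r2 \<le> real_of_int (G2 (m, n))"
      let ?k1 = "G1 (m, n)" and ?k2 = "G2 (m, n)"
      show "\<exists>y\<in>{0..<int n} \<times> ?T t \<times> ?T t. \<Phi> y = (G1, G2) \<and> (?W G1 * ?W G2)
          \<le> (case y of (d, H1, H2) \<Rightarrow> ?C powr K * (?W H1 * ?W H2))"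
      proof (cases "t \<le> real_of_int ?k2")
        \<comment> \<open>Both corner heights already reach \<open>t\<close>, the first because of
          \<open>t \<le> r1\<close>, so no exchange is made.\<close>
        case True
        have "1 * (?W G1 * ?W G2) \<le> ?C powr K * (?W G1 * ?W G2)"
          using W0 G C K0 by (intro mult_right_mono ge_one_powr_ge_zero) auto
        then show ?thesis
          using True G r n \<open>t \<le> r1\<close> by (intro bexI[of _ "(0, G1, G2)"]) (auto simp: \<Phi>_def)
      next
        case False
        \<comment> \<open>These are the integers \<open>d\<close> for which both new corner heights
          \<open>?k2 + d\<close> and \<open>?k1 - d\<close> reach \<open>t\<close>. Rounding costs
          at most 1 at each end and counting both endpoints gives 1 back, hence the
          \<open>- 1\<close> in the bound.\<close>
        define D where "D = {\<lceil>t - ?k2\<rceil>..\<lfloor>?k1 - t\<rfloor>}"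
        have "real (card D) \<ge> real_of_int (\<lfloor>?k1 - t\<rfloor> - \<lceil>t - ?k2\<rceil> + 1)"
          by (simp add: D_def)
        moreover have "real_of_int \<lfloor>?k1 - t\<rfloor> > ?k1 - t - 1" "real_of_int \<lceil>t - ?k2\<rceil> < t - ?k2 + 1"
          by linarith+
        ultimately have card: "r1 + r2 - 2 * t - 1 \<le> real (card D)"
          using r unfolding of_int_diff of_int_add of_int_1 by linarith
        then have "D \<noteq> {}" using L by auto
        moreover have "finite D" by (simp add: D_def)
        ultimately obtain d where d: "d \<in> D"
          and small: "card D * card (interface m n d G1 G2) \<le> 2 * (m * n)"
          using small_interface by blast
        have dt: "t \<le> ?k2 + d" "t \<le> ?k1 - d"
          using d unfolding D_def atLeastAtMost_iff by linarith+
        have k: "0 \<le> ?k2" "?k1 \<le> int n"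
          using heights_bounds[OF G(1), of m n] heights_bounds[OF G(2), of m n] by auto
        \<comment> \<open>Here \<open>?k2 < t\<close>, so \<open>t \<le> ?k2 + d\<close> forces
          \<open>d > 0\<close>, and \<open>t \<le> ?k1 - d\<close> forces
          \<open>d < ?k1 - ?k2\<close>, which is at most \<open>n\<close>.\<close>
        have d_pos: "0 < d" and d_le: "d \<le> ?k1 - ?k2" and d_n: "d < int n"
          using dt False k by linarith+
        obtain H1 H2 where H: "swap m n d (G1, G2) = (H1, H2)"
          by (cases "swap m n d (G1, G2)")
        interpret height_pair m n d G1 G2 H1 H2
          by unfold_locales (use G d_pos d_le H in auto)
        let ?c = "card (interface m n d G1 G2)"
        have "(r1 + r2 - 2 * t - 1) * real ?c \<le> real (card D) * real ?c"
          by (intro mult_right_mono card) simp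
        also have "\<dots> \<le> 2 * real (m * n)"
          using of_nat_mono[OF small, where 'a = real] by (simp only: of_nat_mult of_nat_numeral)
        also note K
        finally have "real ?c \<le> K"
          using L by simp
        then have "?C ^ ?c \<le> ?C powr K"
          using C by (subst powr_realpow[symmetric]) (auto intro: powr_mono)
        then have "?C ^ ?c * (?W H1 * ?W H2) \<le> ?C powr K * (?W H1 * ?W H2)"
          using W0 swap_heights by (intro mult_right_mono mult_nonneg_nonneg)
        with height_weight_swap[OF aq]
        have "?W G1 * ?W G2 \<le> ?C powr K * (?W H1 * ?W H2)"
          unfolding \<delta>_def by (rule order_trans)
        moreover have "swap m n d (H1, H2) = (G1, G2)"
          using swap_swap[of m n d "(G1, G2)"] H by simp
        ultimately have "\<Phi> (d, H1, H2) = (G1, G2) \<and> ?W G1 * ?W G2 \<le> ?C powr K * (?W H1 * ?W H2)"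
          using d_pos by (simp add: \<Phi>_def)
        moreover have "(d, H1, H2) \<in> {0..<int n} \<times> ?T t \<times> ?T t"
          using d_pos d_n swap_heights dt by (simp add: swap_corner)
        ultimately show ?thesis
          by (intro bexI[of _ "(d, H1, H2)"]) simp_all
      qed
    qed
  qed (use fin in auto)
  also have "\<dots> = (\<Sum>d\<in>{0..<int n}. \<Sum>(H1, H2)\<in>?T t \<times> ?T t. ?C powr K * (?W H1 * ?W H2))"
    by (rule sum.cartesian_product[symmetric])
  also have "\<dots> = (\<Sum>d\<in>{0..<int n}. ?C powr K * (tail_weight a q m n t)^2)"
    by (simp only: power2_eq_square product sum_distrib_left case_prod_unfold)
  also have "\<dots> = real n * ?C powr K * (tail_weight a q m n t)^2"
    by (simp only: sum_constant card_atLeastLessThan_int) simp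
  finally show ?thesis .
qed

theorem theorem1p1:
  fixes P :: "'w measure" and \<eta> :: "'w \<Rightarrow> s6v_config"
    and a q C r1 r2 :: real and M N :: nat
  assumes "0 < a" "a < 1" "0 < q" "q < 1"
    and "stochastic_six_vertex P a q \<eta>"
    and "8 \<le> M" "8 \<le> N"
    and "0 \<le> r1" "0 \<le> r2"
  defines "C \<equiv> a powi (-2) * q powi (-2) * (1 - a) powi (-2) * (1 - q) powi (-2) * (1 - a * q) ^ 4"
  shows "\<P>(\<omega> in P. real_of_int (s6v_height (\<eta> \<omega>) M N) \<ge> r1) *
         \<P>(\<omega> in P. real_of_int (s6v_height (\<eta> \<omega>) M N) \<ge> r2)
         \<le> (real N)\<^sup>2 * C powr (real (M * N) powr (4 / 5)) *
           (\<P>(\<omega> in P. real_of_int (s6v_height (\<eta> \<omega>) M N)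
                      \<ge> (r1 + r2) / 2 - 4 * real (M * N) powr (2 / 5)))\<^sup>2"
proof -
  interpret stochastic_six_vertex P a q \<eta> by fact
  define m where "m = M - 1"
  define X where "X = real (M * N)"
  have M: "M = Suc m" using \<open>8 \<le> M\<close> by (simp add: m_def)
  have aq: "a * q < 1" using assms(1-4) mult_strict_mono[of a 1 q 1] by simp
  have prob: "\<P>(\<omega> in P. real_of_int (s6v_height (\<eta> \<omega>) M N) \<ge> r) = tail_weight a q m N r" for r
    unfolding M tail_weight_def using aq \<open>8 \<le> N\<close> by (intro prob_height_ge) auto
  have C: "C = 1 / (a * q * (1 - a) * (1 - q) / (1 - a * q)^2)^2"
    unfolding C_def
    by (simp add: power_int_minus power_mult_distrib power_divide divide_inverse mult_ac
        power_inverse flip: power_mult)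
  let ?t = "(r1 + r2) / 2 - 4 * X powr (2 / 5)"
  have "8 * 8 \<le> M * N" using assms(6,7) by (rule mult_le_mono)
  then have X: "1 \<le> X" unfolding X_def by linarith
  then have Q: "1 \<le> X powr (2 / 5)" by (simp add: ge_one_powr_ge_zero)
  \<comment> \<open>The allowance \<open>4 * X powr (2 / 5)\<close> leaves at least
    \<open>8 * X powr (2 / 5) - 1\<close> values of \<open>d\<close>. This is at least
    \<open>7 * X powr (2 / 5)\<close>, enough for an interface of at most
    \<open>X powr (4 / 5)\<close> vertices.\<close>
  have "X powr 1 \<le> X powr (6 / 5)" using X by (intro powr_mono) auto
  then have "2 * X \<le> 7 * X powr (6 / 5)" using X by simp
  also have "\<dots> = 7 * X powr (2 / 5) * X powr (4 / 5)"
    using X by (simp flip: powr_add)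
  also have "\<dots> \<le> (8 * X powr (2 / 5) - 1) * X powr (4 / 5)"
    using Q by (intro mult_right_mono) auto
  finally have K: "2 * real (m * N) \<le> (8 * X powr (2 / 5) - 1) * X powr (4 / 5)"
    by (simp add: X_def M algebra_simps)
  \<comment> \<open>\<open>tail_weight_mult_le\<close> wants \<open>?t\<close> below its first
    threshold; the larger of the two is at least their mean, so the thresholds are ordered
    first.\<close>
  have bound: "tail_weight a q m N s1 * tail_weight a q m N s2
      \<le> real N * C powr (X powr (4 / 5)) * (tail_weight a q m N ?t)^2"
    if "s2 \<le> s1" "s1 + s2 = r1 + r2" for s1 s2
    unfolding C
  proof (rule tail_weight_mult_le[OF assms(1-4)])
    have eq: "s1 + s2 - 2 * ?t - 1 = 8 * X powr (2 / 5) - 1"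
      using that(2) by (simp add: field_simps)
    show "0 < s1 + s2 - 2 * ?t - 1"
      unfolding eq using Q by simp
    show "2 * real (m * N) \<le> (s1 + s2 - 2 * ?t - 1) * X powr (4 / 5)"
      unfolding eq by (rule K)
    have "(r1 + r2) / 2 \<le> s1" using that by simp
    then show "?t \<le> s1" using Q by linarith
  qed (use \<open>8 \<le> N\<close> in simp)
  have "tail_weight a q m N r1 * tail_weight a q m N r2
      \<le> real N * C powr (X powr (4 / 5)) * (tail_weight a q m N ?t)^2"
    using bound[of r2 r1] bound[of r1 r2] by (cases "r2 \<le> r1") (auto simp: mult.commute)
  \<comment> \<open>The exchange loses a factor \<open>N\<close>, which is at most
    \<open>N^2\<close>.\<close>
  also have "\<dots> \<le> (real N)\<^sup>2 * C powr (X powr (4 / 5)) * (tail_weight a q m N ?t)^2"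
    using \<open>8 \<le> N\<close> by (intro mult_right_mono) (auto simp: power2_eq_square)
  finally show ?thesis
    unfolding prob X_def .
qed

end
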